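(* If $R$ is a noetherian unique factorization domain, then the iterated polynomial ring $R[X][Y]$ is a unique factorization domain.
   Context: Rings are commutative with identity; a unique factorization domain is in particular an integral domain. $R[X][Y]$ denotes the polynomial ring in $Y$ over the polynomial ring $R[X]$. *)

theory Defs
  imports "HOL-Algebra.Ring_Divisibility" "HOL-Algebra.UnivPoly"
begin

end

theory Submission
  imports Defs
begin


text \<open>
  The theorem is Gauss's lemma, applied twice: a polynomial ring \<open>R[X]\<close> over a unique
  factorization domain \<open>R\<close> is again one. A domain is a unique factorization domain as soon as
  proper divisors cannot descend for ever and every irreducible element is prime. The first
  condition holds in \<open>R[X]\<close> because a proper divisor has smaller degree, or else the same degree
  and a leading coefficient with fewer prime factors.

  For the second condition the usual proof compares \<open>R[X]\<close> with the principal ideal domain \<open>K[X]\<close>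
  over the field of fractions \<open>K\<close> of \<open>R\<close>. Here the computations in \<open>K[X]\<close> are replaced by
  computations in \<open>R[X]\<close> up to a nonzero constant factor. A prime of \<open>R\<close> stays prime in \<open>R[X]\<close>
  (lemma \<open>prime_const\<close>), so an equation \<open>a f = d q\<close> with a nonzero constant \<open>a\<close> can be cleared of
  \<open>a\<close>: the prime factors of \<open>a\<close> can be divided out of \<open>d\<close> and \<open>q\<close> one by one, which leaves
  \<open>f = d' q'\<close> (lemma \<open>const_multiple_splits\<close>). Now let \<open>f\<close> be irreducible of positive degree and
  divide \<open>g h\<close>. An element \<open>d\<close> of minimal degree in the ideal \<open>(f, g)\<close> plays the role of the
  greatest common divisor over \<open>K\<close>: by pseudo-division it divides \<open>f\<close> and \<open>g\<close> up to constants.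
  Clearing constants from \<open>a f = d q\<close> and using that \<open>f\<close> is irreducible, either \<open>d\<close> is a constant
  multiple of \<open>f\<close>, and then \<open>f\<close> divides a constant multiple of \<open>g\<close>, or \<open>d = u f + v g\<close> is itself a
  constant, and then \<open>f\<close> divides the constant multiple \<open>d h = u f h + v g h\<close> of \<open>h\<close>. An irreducible
  polynomial of positive degree dividing a constant multiple of a polynomial divides the polynomial
  itself, again by clearing constants.
\<close>

section \<open>Products of primes and divisibility of sums\<close>

text \<open>
  Each prime in the product on the left divides one of the two factors on the right and can be
  cancelled there; \<open>b\<close> and \<open>c\<close> collect the primes that went to \<open>d\<close> and to \<open>q\<close>.
\<close>

lemma (in comm_monoid_cancel) prime_product_splits:
  assumes "set ps \<subseteq> carrier G" and "\<forall>p \<in> set ps. prime G p"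
    and "f \<in> carrier G" "d \<in> carrier G" "q \<in> carrier G"
    and "foldr (\<otimes>) ps \<one> \<otimes> f = d \<otimes> q"
  shows "\<exists>b \<in> carrier G. \<exists>c \<in> carrier G. \<exists>d' \<in> carrier G. \<exists>q' \<in> carrier G.
    b \<otimes> c = foldr (\<otimes>) ps \<one> \<and> d = b \<otimes> d' \<and> q = c \<otimes> q' \<and> f = d' \<otimes> q'"
  using assms
proof (induction ps arbitrary: d q)
  case Nil
  then show ?case by (intro bexI[of _ \<one>] bexI[of _ d] bexI[of _ q]) auto
next
  case (Cons p ps)
  define a where "a = foldr (\<otimes>) ps \<one>"
  have p: "p \<in> carrier G" "prime G p" and a: "a \<in> carrier G"
    using Cons.prems by (auto simp: a_def)
  have eq: "p \<otimes> (a \<otimes> f) = d \<otimes> q"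
    using Cons.prems p a by (simp add: a_def m_assoc)
  then have "p divides d \<otimes> q"
    using a Cons.prems by (metis dividesI m_closed)
  then have "p divides d \<or> p divides q"
    using p Cons.prems by (auto simp: prime_def)
  then show ?case
  proof
    assume "p divides d"
    then obtain e where e: "e \<in> carrier G" "d = p \<otimes> e" by (auto simp: factor_def)
    have "p \<otimes> (a \<otimes> f) = p \<otimes> (e \<otimes> q)"
      using eq e p Cons.prems by (simp add: m_assoc)
    then have "a \<otimes> f = e \<otimes> q"
      using p a e Cons.prems by (meson l_cancel m_closed)
    then obtain b c d' q' where s: "b \<in> carrier G" "c \<in> carrier G" "d' \<in> carrier G" "q' \<in> carrier G"
        "b \<otimes> c = a" "e = b \<otimes> d'" "q = c \<otimes> q'" "f = d' \<otimes> q'"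
      using Cons.IH[of e q] Cons.prems e by (auto simp: a_def)
    then show ?thesis
      using p e by (intro bexI[of _ "p \<otimes> b"] bexI[of _ c] bexI[of _ d'] bexI[of _ q'])
        (auto simp: m_assoc simp flip: a_def)
  next
    assume "p divides q"
    then obtain e where e: "e \<in> carrier G" "q = p \<otimes> e" by (auto simp: factor_def)
    have "p \<otimes> (a \<otimes> f) = p \<otimes> (d \<otimes> e)"
      using eq e p Cons.prems by (simp add: m_lcomm)
    then have "a \<otimes> f = d \<otimes> e"
      using p a e Cons.prems by (meson l_cancel m_closed)
    then obtain b c d' q' where s: "b \<in> carrier G" "c \<in> carrier G" "d' \<in> carrier G" "q' \<in> carrier G"
        "b \<otimes> c = a" "d = b \<otimes> d'" "e = c \<otimes> q'" "f = d' \<otimes> q'"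
      using Cons.IH[of d e] Cons.prems e by (auto simp: a_def)
    then show ?thesis
      using p e by (intro bexI[of _ b] bexI[of _ "p \<otimes> c"] bexI[of _ d'] bexI[of _ q'])
        (auto simp: m_assoc m_lcomm simp flip: a_def)
  qed
qed

lemma (in cring) divides_add:
  assumes "p \<in> carrier R" "a \<in> carrier R" "b \<in> carrier R" "p divides a" "p divides b"
  shows "p divides (a \<oplus> b)"
proof -
  obtain x y where "x \<in> carrier R" "a = p \<otimes> x" "y \<in> carrier R" "b = p \<otimes> y"
    using assms by (auto simp: factor_def)
  then show ?thesis
    using assms by (intro dividesI[of "x \<oplus> y"]) (auto simp: r_distr)
qed

lemma (in cring) divides_add_cancel:
  assumes "p \<in> carrier R" "a \<in> carrier R" "b \<in> carrier R" "p divides (a \<oplus> b)" "p divides b"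
  shows "p divides a"
proof -
  obtain x y where "x \<in> carrier R" "a \<oplus> b = p \<otimes> x" "y \<in> carrier R" "b = p \<otimes> y"
    using assms by (auto simp: factor_def)
  moreover have "a = (a \<oplus> b) \<ominus> b"
    using assms by algebra
  ultimately have "a = p \<otimes> (x \<ominus> y)"
    using assms(1) by algebra
  then show ?thesis
    using \<open>x \<in> carrier R\<close> \<open>y \<in> carrier R\<close> by (auto intro: dividesI[of "x \<ominus> y"])
qed

lemma (in cring) divides_finsum:
  assumes "p \<in> carrier R" "finite A" "g \<in> A \<rightarrow> carrier R" "\<And>i. i \<in> A \<Longrightarrow> p divides (g i)"
  shows "p divides (finsum R g A)"
  using assms(2-)
proof (induction A)
  case empty
  then show ?case using assms(1) divides_zero by simp
next
  case (insert x A)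
  then show ?case
    using assms(1) by (auto intro!: divides_add finsum_closed)
qed


section \<open>Constant polynomials\<close>

context UP_cring
begin

lemma monom_const_mult:
  "\<lbrakk>a \<in> carrier R; b \<in> carrier R\<rbrakk> \<Longrightarrow> monom P (a \<otimes> b) 0 = monom P a 0 \<otimes>\<^bsub>P\<^esub> monom P b 0"
  using monom_mult[of a b 0 0] by simp

lemma monom_const_eq_zero_iff:
  "a \<in> carrier R \<Longrightarrow> monom P a 0 = \<zero>\<^bsub>P\<^esub> \<longleftrightarrow> a = \<zero>"
  using coeff_monom[of a 0 0] by (metis coeff_zero monom_zero)

text \<open>
  Divisibility by a constant is a coefficientwise condition. A choice of quotients for all the
  coefficients need not have finite support, hence the detour over the representation of
  \<open>f\<close> as a finite sum of monomials.
\<close>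

lemma const_divides_iff:
  assumes p: "p \<in> carrier R" and f: "f \<in> carrier P"
  shows "monom P p 0 divides\<^bsub>P\<^esub> f \<longleftrightarrow> (\<forall>n. p divides coeff P f n)"
proof
  assume "monom P p 0 divides\<^bsub>P\<^esub> f"
  then obtain q where "q \<in> carrier P" "f = p \<odot>\<^bsub>P\<^esub> q"
    using p by (auto simp: factor_def monom_mult_is_smult)
  then show "\<forall>n. p divides coeff P f n"
    using p by (auto simp: factor_def)
next
  assume "\<forall>n. p divides coeff P f n"
  then obtain c where c: "\<And>n. c n \<in> carrier R" "\<And>n. coeff P f n = p \<otimes> c n"
    unfolding factor_def by metis
  have "monom P (coeff P f i) i = monom P p 0 \<otimes>\<^bsub>P\<^esub> monom P (c i) i" for i
    using monom_mult[OF p c(1)[of i], of 0 i] c(2) by (simp del: monom_mult)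
  then have "monom P p 0 divides\<^bsub>P\<^esub> monom P (coeff P f i) i" for i
    using c by (intro dividesI[of "monom P (c i) i"]) auto
  then have "monom P p 0 divides\<^bsub>P\<^esub> (\<Oplus>\<^bsub>P\<^esub> i \<in> {..deg R f}. monom P (coeff P f i) i)"
    using p f by (intro P.divides_finsum) auto
  then show "monom P p 0 divides\<^bsub>P\<^esub> f"
    using up_repr[OF f] by simp
qed

lemma const_Unit_iff:
  assumes "a \<in> carrier R"
  shows "monom P a 0 \<in> Units P \<longleftrightarrow> a \<in> Units R"
proof -
  have "monom P a 0 \<in> Units P \<longleftrightarrow> monom P a 0 divides\<^bsub>P\<^esub> \<one>\<^bsub>P\<^esub>"
    using P.divides_one[of "monom P a 0"] assms by simp
  also have "\<dots> \<longleftrightarrow> a divides \<one>"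
    using assms R.divides_zero by (auto simp: const_divides_iff)
  also have "\<dots> \<longleftrightarrow> a \<in> Units R"
    using R.divides_one[OF assms] .
  finally show ?thesis .
qed

text \<open>
  If \<open>p\<close> divides neither \<open>g\<close> nor \<open>h\<close>, let \<open>i\<close> and \<open>j\<close> be the least indices of coefficients not
  divisible by \<open>p\<close>. In the coefficient of \<open>g h\<close> at \<open>i + j\<close> all summands but one are divisible
  by \<open>p\<close>, so \<open>p\<close> does not divide \<open>g h\<close>.
\<close>

lemma prime_const:
  assumes p: "p \<in> carrier R" "prime R p"
  shows "prime P (monom P p 0)"
proof (rule primeI)
  show "monom P p 0 \<notin> Units P"
    using p const_Unit_iff by (auto simp: prime_def)
next
  fix g h assume gh: "g \<in> carrier P" "h \<in> carrier P"
    and dvd: "monom P p 0 divides\<^bsub>P\<^esub> g \<otimes>\<^bsub>P\<^esub> h"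
  show "monom P p 0 divides\<^bsub>P\<^esub> g \<or> monom P p 0 divides\<^bsub>P\<^esub> h"
  proof (rule ccontr)
    assume "\<not> ?thesis"
    then have ex: "\<exists>i. \<not> p divides coeff P g i" "\<exists>j. \<not> p divides coeff P h j"
      using p gh by (auto simp: const_divides_iff)
    define i where "i = (LEAST i. \<not> p divides coeff P g i)"
    define j where "j = (LEAST j. \<not> p divides coeff P h j)"
    have i: "\<not> p divides coeff P g i" and j: "\<not> p divides coeff P h j"
      using ex LeastI_ex unfolding i_def j_def by metis+
    let ?t = "\<lambda>k. coeff P g k \<otimes> coeff P h (i + j - k)"
    have t: "?t \<in> A \<rightarrow> carrier R" for A
      using gh by auto
    have rest: "p divides (\<Oplus>k \<in> {..i + j} - {i}. ?t k)"
    proof (rule R.divides_finsum)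
      fix k assume "k \<in> {..i + j} - {i}"
      then consider "k < i" | "i + j - k < j" by force
      then have "p divides coeff P g k \<or> p divides coeff P h (i + j - k)"
        unfolding i_def j_def by cases (auto dest: not_less_Least)
      then show "p divides ?t k"
        using gh p(1) R.divides_prod_r R.divides_prod_l coeff_closed by metis
    qed (use p t in auto)
    have "coeff P (g \<otimes>\<^bsub>P\<^esub> h) (i + j) = (\<Oplus>k \<in> insert i ({..i + j} - {i}). ?t k)"
      using gh by (simp add: insert_absorb)
    also have "\<dots> = ?t i \<oplus> (\<Oplus>k \<in> {..i + j} - {i}. ?t k)"
      using gh by (subst R.finsum_insert) auto
    finally have conv: "coeff P (g \<otimes>\<^bsub>P\<^esub> h) (i + j) = ?t i \<oplus> (\<Oplus>k \<in> {..i + j} - {i}. ?t k)" .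
    have "p divides coeff P (g \<otimes>\<^bsub>P\<^esub> h) (i + j)"
      using dvd const_divides_iff[OF p(1) UP_mult_closed[OF gh]] by blast
    then have "p divides (?t i \<oplus> (\<Oplus>k \<in> {..i + j} - {i}. ?t k))"
      by (simp only: conv)
    moreover have "?t i \<in> carrier R"
      using gh by simp
    ultimately have "p divides ?t i"
      using R.divides_add_cancel[OF p(1) _ R.finsum_closed[OF t] _ rest] by blast
    then have "p divides (coeff P g i \<otimes> coeff P h j)"
      by simp
    then show False
      using i j p(2) coeff_closed[OF gh(1)] coeff_closed[OF gh(2)] unfolding prime_def by blast
  qed
qed

end

section \<open>Clearing constants from a factorization\<close>

context UP_domain
begin

lemma deg_factors_of_const:
  assumes "p \<in> carrier P" "q \<in> carrier P" "p \<otimes>\<^bsub>P\<^esub> q \<noteq> \<zero>\<^bsub>P\<^esub>" "deg R (p \<otimes>\<^bsub>P\<^esub> q) = 0"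
  shows "deg R p = 0" "deg R q = 0"
proof -
  have "p \<noteq> \<zero>\<^bsub>P\<^esub>" "q \<noteq> \<zero>\<^bsub>P\<^esub>"
    using assms by auto
  then show "deg R p = 0" "deg R q = 0"
    using assms deg_mult[of p q] by auto
qed

lemma deg_Unit:
  assumes "u \<in> Units P"
  shows "deg R u = 0"
proof -
  obtain v where "u \<in> carrier P" "v \<in> carrier P" "u \<otimes>\<^bsub>P\<^esub> v = \<one>\<^bsub>P\<^esub>"
    using assms unfolding Units_def by auto
  then show ?thesis
    using deg_factors_of_const[of u v] by simp
qed

text \<open>
  This is Gauss's lemma in the form used below: a factorization of \<open>f\<close> up to a constant, that is,
  over the field of fractions, yields a factorization of \<open>f\<close> itself whose factors agree with
  the given ones up to constants.
\<close>

lemma const_multiple_splits: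
  assumes fd: "factorial_domain R"
    and a: "a \<in> carrier R" "a \<noteq> \<zero>"
    and f: "f \<in> carrier P" "f \<noteq> \<zero>\<^bsub>P\<^esub>" and d: "d \<in> carrier P" "d \<noteq> \<zero>\<^bsub>P\<^esub>"
    and q: "q \<in> carrier P" "q \<noteq> \<zero>\<^bsub>P\<^esub>"
    and eq: "monom P a 0 \<otimes>\<^bsub>P\<^esub> f = d \<otimes>\<^bsub>P\<^esub> q"
  obtains b c d' q' where
    "b \<in> carrier P" "c \<in> carrier P" "d' \<in> carrier P" "q' \<in> carrier P"
    "deg R b = 0" "deg R c = 0"
    "d = b \<otimes>\<^bsub>P\<^esub> d'" "q = c \<otimes>\<^bsub>P\<^esub> q'" "f = d' \<otimes>\<^bsub>P\<^esub> q'"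
proof -
  interpret F: factorial_monoid "mult_of R"
    using fd by (simp add: factorial_domain_def)
  obtain fs where fs: "set fs \<subseteq> carrier (mult_of R)" "wfactors (mult_of R) fs a"
    using F.wfactors_exist[of a] a by auto
  define e where "e = foldr (\<otimes>) fs \<one>"
  have "e \<in> carrier (mult_of R)"
    using R.mult_of.multlist_closed[OF fs(1)] by (simp add: e_def)
  then have e: "e \<in> carrier R" "e \<noteq> \<zero>" by auto
  have "\<exists>u \<in> Units (mult_of R). e = a \<otimes> u"
    using R.mult_of.associated_iff[of e a] fs(2) a e unfolding wfactors_def e_def by simp
  then obtain u v where uv: "u \<in> carrier R" "v \<in> carrier R" "u \<otimes> v = \<one>" "e = a \<otimes> u"
    by (auto simp: Units_def)
  \<comment> \<open>The factorization of \<open>a\<close> exists up to a unit \<open>u\<close> only; \<open>u\<close> is absorbed into \<open>q\<close> and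
    removed from \<open>c\<close> in the end.\<close>
  let ?ps = "map (\<lambda>x. monom P x 0) fs"
  have ps_prod: "foldr (\<otimes>\<^bsub>P\<^esub>) ?ps \<one>\<^bsub>P\<^esub> = monom P e 0"
    using fs(1) R.mult_of.multlist_closed unfolding e_def
    by (induction fs) (auto simp: monom_const_mult)
  have ps: "set ?ps \<subseteq> carrier (mult_of P)" "\<forall>p \<in> set ?ps. prime (mult_of P) p"
  proof -
    show "set ?ps \<subseteq> carrier (mult_of P)"
      using fs(1) by (auto simp: monom_const_eq_zero_iff)
    have "prime (mult_of P) (monom P x 0)" if "x \<in> set fs" for x
    proof -
      have x: "x \<in> carrier (mult_of R)" "irreducible (mult_of R) x"
        using that fs by (auto simp: wfactors_def)
      then have "prime R x"
        using F.irreducible_prime R.prime_eq_prime_mult by auto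
      then have "prime P (monom P x 0)"
        using x prime_const by auto
      then show ?thesis
        using domain.prime_eq_prime_mult[OF UP_domain] x by auto
    qed
    then show "\<forall>p \<in> set ?ps. prime (mult_of P) p" by auto
  qed
  have "monom P e 0 \<otimes>\<^bsub>P\<^esub> f = monom P u 0 \<otimes>\<^bsub>P\<^esub> (monom P a 0 \<otimes>\<^bsub>P\<^esub> f)"
    using uv a f by (simp add: monom_const_mult P.m_ac)
  also have "\<dots> = d \<otimes>\<^bsub>P\<^esub> (q \<otimes>\<^bsub>P\<^esub> monom P u 0)"
    using uv d q by (simp add: eq P.m_ac)
  finally have "foldr (\<otimes>\<^bsub>P\<^esub>) ?ps \<one>\<^bsub>P\<^esub> \<otimes>\<^bsub>P\<^esub> f = d \<otimes>\<^bsub>P\<^esub> (q \<otimes>\<^bsub>P\<^esub> monom P u 0)"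
    by (simp only: ps_prod)
  moreover have "q \<otimes>\<^bsub>P\<^esub> monom P u 0 \<in> carrier (mult_of P)"
  proof -
    have "u \<noteq> \<zero>" using uv e a by auto
    then show ?thesis
      using uv q UP_integral[of q "monom P u 0"] by (auto simp: monom_const_eq_zero_iff)
  qed
  ultimately obtain b c d' q' where s: "b \<in> carrier (mult_of P)" "c \<in> carrier (mult_of P)"
      "d' \<in> carrier (mult_of P)" "q' \<in> carrier (mult_of P)" "b \<otimes>\<^bsub>P\<^esub> c = monom P e 0"
      "d = b \<otimes>\<^bsub>P\<^esub> d'" "q \<otimes>\<^bsub>P\<^esub> monom P u 0 = c \<otimes>\<^bsub>P\<^esub> q'" "f = d' \<otimes>\<^bsub>P\<^esub> q'"
    using mult_of.prime_product_splits[OF ps, of f d "q \<otimes>\<^bsub>P\<^esub> monom P u 0"] f d ps_prod by auto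
  have "q = q \<otimes>\<^bsub>P\<^esub> monom P u 0 \<otimes>\<^bsub>P\<^esub> monom P v 0"
    using uv q by (simp add: P.m_assoc flip: monom_const_mult)
  also have "\<dots> = (c \<otimes>\<^bsub>P\<^esub> monom P v 0) \<otimes>\<^bsub>P\<^esub> q'"
    using s uv by (simp add: P.m_ac)
  finally have "q = (c \<otimes>\<^bsub>P\<^esub> monom P v 0) \<otimes>\<^bsub>P\<^esub> q'" .
  moreover have "deg R b = 0" "deg R (c \<otimes>\<^bsub>P\<^esub> monom P v 0) = 0"
  proof -
    have bc: "deg R b = 0" "deg R c = 0"
      using deg_factors_of_const[of b c] s e by (auto simp: monom_const_eq_zero_iff)
    then show "deg R b = 0" "deg R (c \<otimes>\<^bsub>P\<^esub> monom P v 0) = 0"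
      using deg_mult_ring[of c "monom P v 0"] s uv by auto
  qed
  ultimately show thesis
    using that[of b "c \<otimes>\<^bsub>P\<^esub> monom P v 0" d' q'] s uv by auto
qed

text \<open>
  Pseudo-division by \<open>d\<close> leaves a remainder in the ideal of smaller degree than \<open>d\<close>, which must
  be zero. Over a field this says that \<open>d\<close> generates the ideal.
\<close>

lemma ideal_minimal_degree:
  assumes I: "ideal I P" and d: "d \<in> I" "d \<noteq> \<zero>\<^bsub>P\<^esub>"
    and min: "\<And>x. x \<in> I \<Longrightarrow> x \<noteq> \<zero>\<^bsub>P\<^esub> \<Longrightarrow> deg R d \<le> deg R x"
    and f: "f \<in> I"
  obtains a q where "a \<in> carrier R" "a \<noteq> \<zero>" "q \<in> carrier P" "monom P a 0 \<otimes>\<^bsub>P\<^esub> f = d \<otimes>\<^bsub>P\<^esub> q"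
proof -
  interpret I: ideal I P by fact
  have fP: "f \<in> carrier P" and dP: "d \<in> carrier P"
    using f d I.Icarr by auto
  obtain q r and k :: nat where qr: "q \<in> carrier P" "r \<in> carrier P"
    and div: "lcoeff d [^] k \<odot>\<^bsub>P\<^esub> f = d \<otimes>\<^bsub>P\<^esub> q \<oplus>\<^bsub>P\<^esub> r"
    and r: "r = \<zero>\<^bsub>P\<^esub> \<or> deg R r < deg R d"
    using long_div_theorem[OF dP fP d(2)] by auto
  define a where "a = lcoeff d [^] k"
  have a: "a \<in> carrier R" "a \<noteq> \<zero>"
  proof -
    have "lcoeff d \<in> carrier R" "lcoeff d \<noteq> \<zero>"
      using dP d(2) lcoeff_nonzero by auto
    then show "a \<in> carrier R" "a \<noteq> \<zero>"
      unfolding a_def by (induction k) (auto simp: R.integral_iff)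
  qed
  have div': "monom P a 0 \<otimes>\<^bsub>P\<^esub> f = d \<otimes>\<^bsub>P\<^esub> q \<oplus>\<^bsub>P\<^esub> r"
    using div a fP by (simp add: monom_mult_is_smult a_def)
  have "d \<otimes>\<^bsub>P\<^esub> q \<oplus>\<^bsub>P\<^esub> r \<in> I"
    unfolding div'[symmetric] using f a by (intro I.I_l_closed) auto
  moreover have "\<ominus>\<^bsub>P\<^esub> (d \<otimes>\<^bsub>P\<^esub> q) \<in> I"
    using d(1) qr(1) by (intro I.a_inv_closed I.I_r_closed)
  ultimately have "\<ominus>\<^bsub>P\<^esub> (d \<otimes>\<^bsub>P\<^esub> q) \<oplus>\<^bsub>P\<^esub> (d \<otimes>\<^bsub>P\<^esub> q \<oplus>\<^bsub>P\<^esub> r) \<in> I"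
    by (rule I.a_closed[rotated])
  then have "r \<in> I"
    using dP qr by (simp add: P.r_neg1)
  then have "r = \<zero>\<^bsub>P\<^esub>"
    using r min[of r] by fastforce
  then show thesis
    using that[OF a qr(1)] div' dP qr by simp
qed



section \<open>Irreducible polynomials are prime\<close>

text \<open>
  In \<open>a g = f s\<close> the constant \<open>a\<close> can be cleared. What is taken out of \<open>f\<close> is a unit, because
  the remaining factor of the irreducible \<open>f\<close> still has positive degree.
\<close>

lemma irreducible_divides_const_multiple:
  assumes fd: "factorial_domain R"
    and f: "f \<in> carrier P" "ring_irreducible\<^bsub>P\<^esub> f" "deg R f \<noteq> 0"
    and a: "a \<in> carrier R" "a \<noteq> \<zero>"
    and g: "g \<in> carrier P"
    and dvd: "f divides\<^bsub>P\<^esub> monom P a 0 \<otimes>\<^bsub>P\<^esub> g"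
  shows "f divides\<^bsub>P\<^esub> g"
proof (cases "g = \<zero>\<^bsub>P\<^esub>")
  case True
  then show ?thesis using P.divides_zero[OF f(1)] by simp
next
  case False
  obtain s where s: "s \<in> carrier P" "monom P a 0 \<otimes>\<^bsub>P\<^esub> g = f \<otimes>\<^bsub>P\<^esub> s"
    using dvd by (auto simp: factor_def)
  have "f \<noteq> \<zero>\<^bsub>P\<^esub>"
    using f(3) deg_zero by auto
  moreover have "s \<noteq> \<zero>\<^bsub>P\<^esub>"
    using s f a g False UP_integral[of "monom P a 0" g] by (auto simp: monom_const_eq_zero_iff)
  ultimately obtain b c f' s' where split:
      "b \<in> carrier P" "c \<in> carrier P" "f' \<in> carrier P" "s' \<in> carrier P"
      "deg R b = 0" "deg R c = 0"
      "f = b \<otimes>\<^bsub>P\<^esub> f'" "s = c \<otimes>\<^bsub>P\<^esub> s'" "g = f' \<otimes>\<^bsub>P\<^esub> s'"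
    using const_multiple_splits[OF fd a g False f(1) _ s(1) _ s(2)] by metis
  have "f' \<notin> Units P"
  proof
    assume "f' \<in> Units P"
    then have "deg R f = 0"
      using deg_Unit[of f'] deg_mult_ring[of b f'] split by simp
    then show False using f(3) by simp
  qed
  then have "b \<in> Units P"
    using domain.ring_irreducibleE(5)[OF UP_domain f(1,2) split(1,3,7)] by blast
  then obtain b' where b': "b' \<in> carrier P" "b' \<otimes>\<^bsub>P\<^esub> b = \<one>\<^bsub>P\<^esub>"
    by (auto simp: Units_def)
  have "g = (b' \<otimes>\<^bsub>P\<^esub> b) \<otimes>\<^bsub>P\<^esub> (f' \<otimes>\<^bsub>P\<^esub> s')"
    using split b' by simp
  also have "\<dots> = f \<otimes>\<^bsub>P\<^esub> (b' \<otimes>\<^bsub>P\<^esub> s')"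
    unfolding split(7) using split(1-4) b'(1) by (simp add: P.m_ac)
  finally show ?thesis
    using split b' by (intro dividesI[of "b' \<otimes>\<^bsub>P\<^esub> s'"]) auto
qed

lemma prime_if_irreducible_nonconst:
  assumes fd: "factorial_domain R"
    and f: "f \<in> carrier P" "ring_irreducible\<^bsub>P\<^esub> f" "deg R f \<noteq> 0"
  shows "prime P f"
proof (rule primeI)
  show "f \<notin> Units P"
    using f deg_Unit by auto
next
  fix g h assume g: "g \<in> carrier P" and h: "h \<in> carrier P" and dvd: "f divides\<^bsub>P\<^esub> g \<otimes>\<^bsub>P\<^esub> h"
  have f0: "f \<noteq> \<zero>\<^bsub>P\<^esub>"
    using f(3) deg_zero by auto
  \<comment> \<open>An element \<open>d\<close> of minimal degree in the ideal of \<open>f\<close> and \<open>g\<close> replaces their greatest common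
    divisor over the field of fractions.\<close>
  define I where "I = PIdl\<^bsub>P\<^esub> f <+>\<^bsub>P\<^esub> PIdl\<^bsub>P\<^esub> g"
  have I: "ideal I P"
    unfolding I_def using f g by (intro P.add_ideals P.cgenideal_ideal)
  have I_iff: "x \<in> I \<longleftrightarrow> (\<exists>u \<in> carrier P. \<exists>v \<in> carrier P. x = u \<otimes>\<^bsub>P\<^esub> f \<oplus>\<^bsub>P\<^esub> v \<otimes>\<^bsub>P\<^esub> g)" for x
    unfolding I_def set_add_def' cgenideal_def by auto
  have fI: "f \<in> I"
    unfolding I_iff using f g by (intro bexI[of _ "\<one>\<^bsub>P\<^esub>"] bexI[of _ "\<zero>\<^bsub>P\<^esub>"]) auto
  have gI: "g \<in> I"
    unfolding I_iff using f g by (intro bexI[of _ "\<zero>\<^bsub>P\<^esub>"] bexI[of _ "\<one>\<^bsub>P\<^esub>"]) auto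
  obtain d where d: "d \<in> I" "d \<noteq> \<zero>\<^bsub>P\<^esub>"
    and min: "\<And>x. x \<in> I \<Longrightarrow> x \<noteq> \<zero>\<^bsub>P\<^esub> \<Longrightarrow> deg R d \<le> deg R x"
    using ex_has_least_nat[of "\<lambda>x. x \<in> I \<and> x \<noteq> \<zero>\<^bsub>P\<^esub>" f "deg R"] fI f0 by auto
  have dP: "d \<in> carrier P"
    using d(1) I ideal.Icarr by metis
  obtain a q where a: "a \<in> carrier R" "a \<noteq> \<zero>" and q: "q \<in> carrier P"
    and aq: "monom P a 0 \<otimes>\<^bsub>P\<^esub> f = d \<otimes>\<^bsub>P\<^esub> q"
    using ideal_minimal_degree[OF I d min fI] by metis
  have "q \<noteq> \<zero>\<^bsub>P\<^esub>"
    using aq f(1) f0 a dP UP_integral[of "monom P a 0" f] by (auto simp: monom_const_eq_zero_iff)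
  then obtain b c d' q' where split:
      "b \<in> carrier P" "c \<in> carrier P" "d' \<in> carrier P" "q' \<in> carrier P"
      "deg R b = 0" "deg R c = 0"
      "d = b \<otimes>\<^bsub>P\<^esub> d'" "q = c \<otimes>\<^bsub>P\<^esub> q'" "f = d' \<otimes>\<^bsub>P\<^esub> q'"
    using const_multiple_splits[OF fd a f(1) f0 dP d(2) q _ aq] by metis
  have "d' \<in> Units P \<or> q' \<in> Units P"
    using domain.ring_irreducibleE(5)[OF UP_domain f(1,2) split(3,4,9)] .
  then show "f divides\<^bsub>P\<^esub> g \<or> f divides\<^bsub>P\<^esub> h"
  proof
    \<comment> \<open>Here \<open>f\<close> and \<open>g\<close> are coprime up to constants: \<open>d\<close> is a constant combination of them.\<close>
    assume "d' \<in> Units P"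
    then have "deg R d = 0"
      using deg_Unit[of d'] deg_mult_ring[of b d'] split by simp
    then obtain e where e: "e \<in> carrier R" "d = monom P e 0"
      using deg_zero_impl_monom[OF dP] coeff_closed[OF dP] by metis
    then have e0: "e \<noteq> \<zero>" using d(2) by auto
    obtain u v where uv: "u \<in> carrier P" "v \<in> carrier P" "d = u \<otimes>\<^bsub>P\<^esub> f \<oplus>\<^bsub>P\<^esub> v \<otimes>\<^bsub>P\<^esub> g"
      using d(1) I_iff by auto
    obtain w where w: "w \<in> carrier P" "g \<otimes>\<^bsub>P\<^esub> h = f \<otimes>\<^bsub>P\<^esub> w"
      using dvd by (auto simp: factor_def)
    have "d \<otimes>\<^bsub>P\<^esub> h = u \<otimes>\<^bsub>P\<^esub> f \<otimes>\<^bsub>P\<^esub> h \<oplus>\<^bsub>P\<^esub> v \<otimes>\<^bsub>P\<^esub> (g \<otimes>\<^bsub>P\<^esub> h)"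
      using uv f g h by (simp add: P.l_distr P.m_assoc)
    also have "\<dots> = f \<otimes>\<^bsub>P\<^esub> (u \<otimes>\<^bsub>P\<^esub> h \<oplus>\<^bsub>P\<^esub> v \<otimes>\<^bsub>P\<^esub> w)"
      using uv f g h w by (simp add: P.r_distr P.m_ac)
    finally have "f divides\<^bsub>P\<^esub> monom P e 0 \<otimes>\<^bsub>P\<^esub> h"
      using e uv h w by (auto intro!: dividesI[of "u \<otimes>\<^bsub>P\<^esub> h \<oplus>\<^bsub>P\<^esub> v \<otimes>\<^bsub>P\<^esub> w"])
    then show ?thesis
      using irreducible_divides_const_multiple[OF fd f e(1) e0 h] by simp
  next
    \<comment> \<open>Here \<open>f\<close> is associated to \<open>d'\<close>, so it divides \<open>d\<close>, and \<open>d\<close> divides a constant multiple of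
      \<open>g\<close>.\<close>
    assume "q' \<in> Units P"
    then obtain r where r: "r \<in> carrier P" "r \<otimes>\<^bsub>P\<^esub> q' = \<one>\<^bsub>P\<^esub>"
      by (auto simp: Units_def)
    obtain a' t where a': "a' \<in> carrier R" "a' \<noteq> \<zero>" and t: "t \<in> carrier P"
      "monom P a' 0 \<otimes>\<^bsub>P\<^esub> g = d \<otimes>\<^bsub>P\<^esub> t"
      using ideal_minimal_degree[OF I d min gI] by metis
    have "monom P a' 0 \<otimes>\<^bsub>P\<^esub> g = (r \<otimes>\<^bsub>P\<^esub> q') \<otimes>\<^bsub>P\<^esub> (b \<otimes>\<^bsub>P\<^esub> d') \<otimes>\<^bsub>P\<^esub> t"
      using t split r by simp
    also have "\<dots> = f \<otimes>\<^bsub>P\<^esub> (r \<otimes>\<^bsub>P\<^esub> b \<otimes>\<^bsub>P\<^esub> t)"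
      unfolding split(9) using split(1-4) r(1) t(1) by (simp add: P.m_ac)
    finally have "f divides\<^bsub>P\<^esub> monom P a' 0 \<otimes>\<^bsub>P\<^esub> g"
      using t split r by (intro dividesI[of "r \<otimes>\<^bsub>P\<^esub> b \<otimes>\<^bsub>P\<^esub> t"]) auto
    then show ?thesis
      using irreducible_divides_const_multiple[OF fd f a' g] by simp
  qed
qed

text \<open>
  A factorization of a constant in \<open>R\<close> is one in the polynomial ring, and the units among the
  constants are those of \<open>R\<close>. So an irreducible constant is irreducible in \<open>R\<close>, hence prime in
  \<open>R\<close>, and then \<open>prime_const\<close> applies.
\<close>

lemma prime_if_irreducible_const:
  assumes fd: "factorial_domain R"
    and f: "f \<in> carrier P" "ring_irreducible\<^bsub>P\<^esub> f" "deg R f = 0"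
  shows "prime P f"
proof -
  interpret F: factorial_monoid "mult_of R"
    using fd by (simp add: factorial_domain_def)
  obtain p where p: "p \<in> carrier R" "f = monom P p 0"
    using deg_zero_impl_monom[OF f(1,3)] coeff_closed[OF f(1)] by metis
  note irr = domain.ring_irreducibleE[OF UP_domain f(1,2)]
  have "ring_irreducible p"
  proof (rule R.ring_irreducibleI)
    show "p \<in> carrier R - {\<zero>}" "p \<notin> Units R"
      using irr(1,4) p by (auto simp: const_Unit_iff)
  next
    fix a b assume ab: "a \<in> carrier R" "b \<in> carrier R" "p = a \<otimes> b"
    then have "f = monom P a 0 \<otimes>\<^bsub>P\<^esub> monom P b 0"
      using p by (simp add: monom_const_mult)
    then show "a \<in> Units R \<or> b \<in> Units R"
      using irr(5)[of "monom P a 0" "monom P b 0"] ab by (simp add: const_Unit_iff)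
  qed
  then have "prime R p"
    using R.ring_irreducibleE(1,3)[OF p(1)] F.irreducible_prime R.prime_eq_prime_mult p(1) by simp
  then show ?thesis
    using prime_const p by simp
qed


section \<open>Factorial polynomial rings\<close>

text \<open>
  For \<open>y = x q\<close> with \<open>q\<close> not a unit, either \<open>q\<close> has positive degree, or \<open>q\<close> is a constant
  nonunit by which the leading coefficient gets multiplied. Hence proper divisors decrease
  lexicographically in the degree and the number of prime factors of the leading coefficient.
\<close>

lemma UP_properfactor_wf:
  assumes fd: "factorial_domain R"
  shows "wf {(x, y). x \<in> carrier (mult_of P) \<and> y \<in> carrier (mult_of P) \<and> properfactor (mult_of P) x y}"
    (is "wf ?r")
proof -
  interpret F: factorial_monoid "mult_of R"
    using fd by (simp add: factorial_domain_def)
  let ?m = "\<lambda>x. (deg R x, factorcount (mult_of R) (lcoeff x))"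
  have "(?m x, ?m y) \<in> less_than <*lex*> less_than" if "(x, y) \<in> ?r" for x y
  proof -
    have xy: "x \<in> carrier P" "y \<in> carrier P" "x \<noteq> \<zero>\<^bsub>P\<^esub>" "y \<noteq> \<zero>\<^bsub>P\<^esub>"
      and pf: "properfactor (mult_of P) x y"
      using that by auto
    obtain q where q: "q \<in> carrier P" "q \<noteq> \<zero>\<^bsub>P\<^esub>" "y = x \<otimes>\<^bsub>P\<^esub> q"
      using pf by (auto simp: properfactor_def factor_def)
    have deg: "deg R y = deg R x + deg R q"
      using xy q by simp
    show ?thesis
    proof (cases "deg R q = 0")
      case False
      then show ?thesis using deg by simp
    next
      case True
      then obtain e where e: "e \<in> carrier R" "q = monom P e 0"
        using deg_zero_impl_monom[OF q(1)] coeff_closed[OF q(1)] by metis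
      have "y = e \<odot>\<^bsub>P\<^esub> x"
        using xy e q by (simp add: P.m_comm[of x] monom_mult_is_smult)
      then have lc: "lcoeff y = lcoeff x \<otimes> e"
        using True deg xy e by (simp add: R.m_comm)
      have "e \<notin> Units R"
      proof
        assume "e \<in> Units R"
        then have "q \<in> Units (mult_of P)"
          using e by (simp add: const_Unit_iff domain.Units_mult_eq_Units[OF UP_domain])
        then have "y \<sim>\<^bsub>mult_of P\<^esub> x"
          using mult_of.associatedI2'[of y x q] q xy by simp
        then show False
          using pf by (simp add: properfactor_def associated_def)
      qed
      then have "properfactor (mult_of R) (lcoeff x) (lcoeff y)"
      proof (intro R.mult_of.properfactorI3[OF lc])
        show "e \<notin> Units (mult_of R)"
          using \<open>e \<notin> Units R\<close> by (simp add: R.Units_mult_eq_Units)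
        show "lcoeff x \<in> carrier (mult_of R)"
          using xy lcoeff_nonzero by simp
        show "e \<in> carrier (mult_of R)"
          using e q(2) by auto
      qed
      then have "factorcount (mult_of R) (lcoeff x) < factorcount (mult_of R) (lcoeff y)"
        using F.properfactor_fcount lcoeff_nonzero xy by simp
      then show ?thesis
        using deg True by simp
    qed
  qed
  then have "?r \<subseteq> inv_image (less_than <*lex*> less_than) ?m"
    by auto
  then show ?thesis
    by (rule wf_subset[rotated]) (intro wf_inv_image wf_lex_prod wf_less_than)
qed

theorem UP_factorial_domain:
  assumes fd: "factorial_domain R"
  shows "factorial_domain P"
proof -
  have "prime (mult_of P) f" if "f \<in> carrier (mult_of P)" "irreducible (mult_of P) f" for f
  proof -
    have f: "f \<in> carrier P" "ring_irreducible\<^bsub>P\<^esub> f"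
      using that domain.ring_irreducibleI'[OF UP_domain, of f] by auto
    then have "prime P f"
      using prime_if_irreducible_const[OF fd] prime_if_irreducible_nonconst[OF fd] by metis
    then show ?thesis
      using domain.prime_eq_prime_mult[OF UP_domain f(1)] by simp
  qed
  then have "primeness_condition_monoid (mult_of P)"
    by (intro primeness_condition_monoid.intro primeness_condition_monoid_axioms.intro
        mult_of.is_comm_monoid_cancel)
  moreover have "divisor_chain_condition_monoid (mult_of P)"
    using UP_properfactor_wf[OF fd]
    by (intro divisor_chain_condition_monoid.intro divisor_chain_condition_monoid_axioms.intro
        mult_of.is_comm_monoid_cancel)
  ultimately have "factorial_monoid (mult_of P)"
    using factorial_condition_one by blast
  then show ?thesis
    using UP_domain by (simp add: factorial_domain_def)
qed

end

corollary factorial_domain_UP: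
  fixes R :: "('a, 'm) ring_scheme"
  assumes "factorial_domain R"
  shows "factorial_domain (UP R)"
  using UP_domain.UP_factorial_domain[OF UP_domain.intro assms] assms
  by (simp add: factorial_domain_def)

theorem corollary7p2:
  fixes R :: "('a, 'm) ring_scheme"
  assumes "noetherian_ring R" and "factorial_domain R"
  shows "factorial_domain (UP (UP R))"
  using assms(2) by (intro factorial_domain_UP)

end
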